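(* Let $(H,d)$ be a Hadamard space, let $\mu\in H$, and let $(X_k)_{k\ge1}$ and $(Y_k)_{k\ge1}$ be two sequences of $H$-valued random variables on a common probability space. Let $S_n^X$ and $b_n^X$ be the inductive mean and the Fréchet mean of $X_1,\dots,X_n$, and $S_n^Y$ and $b_n^Y$ the inductive mean and the Fréchet mean of $Y_1,\dots,Y_n$. Suppose $$\frac1n\sum_{k=1}^n\mathbb{E}\bigl(d(X_k,Y_k)^2\bigr)\to0\quad(n\to\infty).$$ (i) If $S_n^X\to\mu$ in $\mathcal{L}^2(H)$, then $S_n^Y\to\mu$ in $\mathcal{L}^2(H)$. (ii) If $\mathbb{E}\bigl(\max_{1\le k\le n}d(X_k,a)^2\bigr)=o(n)$ for some (and hence all) $a\in H$, and $b_n^X\to\mu$ in $\mathcal{L}^2(H)$, then $b_n^Y\to\mu$ in $\mathcal{L}^2(H)$.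
   Context: A Hadamard space is a complete metric space $(H,d)$ such that for all $x,y\in H$ there is $m\in H$ with $d(z,m)^2\le\frac12 d(z,x)^2+\frac12 d(z,y)^2-\frac14 d(x,y)^2$ for all $z\in H$. Any two points $x,y\in H$ are joined by a unique minimal geodesic, i.e. a map $\gamma:[0,1]\to H$ with $\gamma(0)=x$, $\gamma(1)=y$, $d(\gamma(s),\gamma(t))=|t-s|\,d(x,y)$; write $x\oplus_t y=\gamma(t)$. The inductive mean of $x_1,x_2,\dots$ is defined by $S_1=x_1$, $S_{n+1}=S_n\oplus_{\frac1{n+1}}x_{n+1}$. The Fréchet mean of $x_1,\dots,x_n\in H$ is the unique minimizer $b_n=\operatorname{arg\,min}_{z\in H}\frac1n\sum_{k=1}^n d(x_k,z)^2$. Both are applied pointwise to random variables. A random variable in $H$ is a Borel measurable map from a probability space to $H$. $Z_n\to Z$ in $\mathcal{L}^2(H)$ means $\mathbb{E}(d(Z_n,Z)^2)\to0$. *)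

theory Defs
  imports "HOL-Probability.Probability"
begin

class hadamard_space = complete_space +
  assumes ex_CN_midpoint:
    "\<exists>m. \<forall>z. (dist z m)\<^sup>2 \<le> 1/2 * (dist z x)\<^sup>2 + 1/2 * (dist z y)\<^sup>2 - 1/4 * (dist x y)\<^sup>2"

definition minimal_geodesic :: "'a::metric_space \<Rightarrow> 'a \<Rightarrow> (real \<Rightarrow> 'a) \<Rightarrow> bool" where
  "minimal_geodesic x y \<gamma> \<longleftrightarrow> \<gamma> 0 = x \<and> \<gamma> 1 = y \<and>
     (\<forall>s\<in>{0..1}. \<forall>t\<in>{0..1}. dist (\<gamma> s) (\<gamma> t) = \<bar>t - s\<bar> * dist x y)"

(* Geodesics are functions on all of real and hence unique only on [0,1]; the description therefore
   ranges over the point at time t rather than over the geodesic itself. Meaningful for 0 \<le> t \<le> 1. *)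
definition geodesic_point :: "'a::metric_space \<Rightarrow> real \<Rightarrow> 'a \<Rightarrow> 'a" where
  "geodesic_point x t y = (THE p. \<exists>\<gamma>. minimal_geodesic x y \<gamma> \<and> \<gamma> t = p)"

(* Sequences are indexed from 1: the term with index 0 is never used, and both means are
   meaningful for n \<ge> 1 only. *)
fun inductive_mean :: "(nat \<Rightarrow> 'a::metric_space) \<Rightarrow> nat \<Rightarrow> 'a" where
  "inductive_mean x (Suc 0) = x 1"
| "inductive_mean x (Suc (Suc n)) =
     geodesic_point (inductive_mean x (Suc n)) (1 / real (Suc (Suc n))) (x (Suc (Suc n)))"

definition frechet_mean :: "(nat \<Rightarrow> 'a::metric_space) \<Rightarrow> nat \<Rightarrow> 'a" where
  "frechet_mean x n =
     (THE b. is_arg_min (\<lambda>z. 1 / real n * (\<Sum>k=1..n. (dist (x k) z)\<^sup>2)) (\<lambda>_. True) b)"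

(* If the metric space is not separable, the distance of two Borel measurable maps, and the distance
   of a mean of Borel measurable maps to a point, need not be measurable. The upper
   expectation is defined for every nonnegative function and agrees with the Lebesgue integral on
   measurable ones, whereas the library's nn_integral is a lower integral, and not subadditive,
   on nonmeasurable functions. *)
definition upper_expectation :: "'w measure \<Rightarrow> ('w \<Rightarrow> ennreal) \<Rightarrow> ennreal" where
  "upper_expectation M f =
     (INF g\<in>{g \<in> borel_measurable M. \<forall>\<omega>\<in>space M. f \<omega> \<le> g \<omega>}. \<integral>\<^sup>+\<omega>. g \<omega> \<partial>M)"

lemma upper_expectation_eq_nn_integral:
  assumes "f \<in> borel_measurable M"
  shows "upper_expectation M f = (\<integral>\<^sup>+\<omega>. f \<omega> \<partial>M)"
  unfolding upper_expectation_def
proof (rule antisym)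
  show "(INF g\<in>{g \<in> borel_measurable M. \<forall>\<omega>\<in>space M. f \<omega> \<le> g \<omega>}. \<integral>\<^sup>+\<omega>. g \<omega> \<partial>M) \<le> (\<integral>\<^sup>+\<omega>. f \<omega> \<partial>M)"
    using assms by (intro INF_lower) auto
  show "(\<integral>\<^sup>+\<omega>. f \<omega> \<partial>M) \<le> (INF g\<in>{g \<in> borel_measurable M. \<forall>\<omega>\<in>space M. f \<omega> \<le> g \<omega>}. \<integral>\<^sup>+\<omega>. g \<omega> \<partial>M)"
    by (intro INF_greatest nn_integral_mono) auto
qed

definition tendsto_L2 :: "'w measure \<Rightarrow> (nat \<Rightarrow> 'w \<Rightarrow> 'a::metric_space) \<Rightarrow> ('w \<Rightarrow> 'a) \<Rightarrow> bool" where
  "tendsto_L2 M Z W \<longleftrightarrow>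
     (\<lambda>n. upper_expectation M (\<lambda>\<omega>. ennreal ((dist (Z n \<omega>) (W \<omega>))\<^sup>2))) \<longlonglongrightarrow> 0"

(* E (max_{1 \<le> k \<le> n} d(X_k, a)^2) = o(n), as a limit in the extended reals so that infinite
   expectations are not silently turned into 0. *)
definition max_sq_dist_small :: "'w measure \<Rightarrow> (nat \<Rightarrow> 'w \<Rightarrow> 'a::metric_space) \<Rightarrow> 'a \<Rightarrow> bool" where
  "max_sq_dist_small M X a \<longleftrightarrow>
     (\<lambda>n. upper_expectation M (\<lambda>\<omega>. ennreal (MAX k\<in>{1..n}. (dist (X k \<omega>) a)\<^sup>2)) / of_nat n) \<longlonglongrightarrow> 0"

end

theory Submission
  imports Defs
begin

text \<open>
  Both means are nonexpansive with respect to the normalised \<open>L\<^sup>1\<close> distance of tuples: if \<open>T\<close> is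
  either of them, then \<open>d (T x\<^sub>1 \<dots> x\<^sub>n, T y\<^sub>1 \<dots> y\<^sub>n) \<le> 1/n \<Sum> d (x\<^sub>k, y\<^sub>k)\<close>. Squaring this with Jensen's
  inequality and inserting it into \<open>d (T\<^sup>Y, \<mu>)\<^sup>2 \<le> 2 d (T\<^sup>X, \<mu>)\<^sup>2 + 2 d (T\<^sup>X, T\<^sup>Y)\<^sup>2\<close> bounds the error for
  \<open>Y\<close> by twice the error for \<open>X\<close> plus twice the quantity that is assumed to vanish. Upper
  expectations are monotone and sublinear, so they inherit this pointwise bound.
  The independence of the growth condition from \<open>a\<close> follows in the same way from
  \<open>d (X\<^sub>k, b)\<^sup>2 \<le> 2 d (X\<^sub>k, a)\<^sup>2 + 2 d (a, b)\<^sup>2\<close>, whose last term is constant.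

  For the inductive mean the nonexpansiveness is an induction on \<open>n\<close> that uses the joint convexity
  of the metric along geodesics. For the Frechet mean it comes from adding two variance
  inequalities, that of the barycenter \<open>b\<close> of the \<open>x\<^sub>k\<close> tested at the barycenter \<open>c\<close> of the \<open>y\<^sub>k\<close> and
  vice versa:
  \<open>2 d (b, c)\<^sup>2 \<le> 1/n \<Sum> (d (x\<^sub>k, c)\<^sup>2 + d (y\<^sub>k, b)\<^sup>2 - d (x\<^sub>k, b)\<^sup>2 - d (y\<^sub>k, c)\<^sup>2)\<close>. Each summand is at
  most \<open>2 d (x\<^sub>k, y\<^sub>k) d (b, c)\<close> by the quadrilateral inequality of nonpositive curvature.

  Everything geometric rests on extending the midpoint axiom to all points of a geodesic, which also
  produces the geodesics themselves.
\<close>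

section \<open>Geodesics in Hadamard spaces\<close>

text \<open>
  The comparison inequality of nonpositive curvature at time \<open>t\<close>. Being quantified over all test
  points \<open>z\<close>, it passes to limits and, by the midpoint axiom, to midpoints; tested at suitable \<open>z\<close> it
  gives the distances between comparison points.
\<close>

definition comparison_point :: "'a::metric_space \<Rightarrow> 'a \<Rightarrow> real \<Rightarrow> 'a \<Rightarrow> bool" where
  "comparison_point x y t p \<longleftrightarrow>
     (\<forall>z. (dist z p)\<^sup>2 \<le> (1 - t) * (dist z x)\<^sup>2 + t * (dist z y)\<^sup>2 - t * (1 - t) * (dist x y)\<^sup>2)"

lemma comparison_pointD:
  assumes "comparison_point x y t p"
  shows "(dist z p)\<^sup>2 \<le> (1 - t) * (dist z x)\<^sup>2 + t * (dist z y)\<^sup>2 - t * (1 - t) * (dist x y)\<^sup>2"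
  using assms unfolding comparison_point_def by blast

lemma comparison_point_start: "comparison_point x y 0 x"
  by (simp add: comparison_point_def)

lemma comparison_point_end: "comparison_point x y 1 y"
  by (simp add: comparison_point_def)

lemma comparison_point_reverse:
  assumes "comparison_point x y t p"
  shows "comparison_point y x (1 - t) p"
  unfolding comparison_point_def
proof
  fix z
  show "(dist z p)\<^sup>2 \<le> (1 - (1 - t)) * (dist z y)\<^sup>2 + (1 - t) * (dist z x)\<^sup>2
      - (1 - t) * (1 - (1 - t)) * (dist y x)\<^sup>2"
    using comparison_pointD[OF assms, of z]
    by (simp add: dist_commute[of y x] mult.commute[of "1 - t" t])
qed

lemma dist_start_comparison_point_le:
  assumes "comparison_point x y t p" "0 \<le> t"
  shows "dist x p \<le> t * dist x y"
proof (rule power2_le_imp_le)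
  show "(dist x p)\<^sup>2 \<le> (t * dist x y)\<^sup>2"
    using comparison_pointD[OF assms(1), of x] by (simp add: power2_eq_square algebra_simps)
qed (use assms in simp)

lemma dist_end_comparison_point_le:
  assumes "comparison_point x y t p" "t \<le> 1"
  shows "dist y p \<le> (1 - t) * dist x y"
proof (rule power2_le_imp_le)
  show "(dist y p)\<^sup>2 \<le> ((1 - t) * dist x y)\<^sup>2"
    using comparison_pointD[OF assms(1), of y]
    by (simp add: power2_eq_square algebra_simps dist_commute)
qed (use assms in simp)

lemma dist_comparison_points_ordered:
  assumes p: "comparison_point x y s p" and q: "comparison_point x y t q"
    and "0 \<le> s" "s \<le> t" "t \<le> 1"
  shows "dist p q = (t - s) * dist x y"
proof (rule antisym)
  define D where "D = dist x y"
  have xq: "(dist q x)\<^sup>2 \<le> (t * D)\<^sup>2" and yq: "(dist q y)\<^sup>2 \<le> ((1 - t) * D)\<^sup>2"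
    using dist_start_comparison_point_le[OF q] dist_end_comparison_point_le[OF q] assms
    by (auto intro!: power_mono simp: D_def dist_commute)
  have "(dist q p)\<^sup>2 \<le> (1 - s) * (dist q x)\<^sup>2 + s * (dist q y)\<^sup>2 - s * (1 - s) * D\<^sup>2"
    unfolding D_def by (rule comparison_pointD[OF p])
  also have "\<dots> \<le> (1 - s) * (t * D)\<^sup>2 + s * ((1 - t) * D)\<^sup>2 - s * (1 - s) * D\<^sup>2"
    using xq yq assms by (intro diff_mono add_mono mult_left_mono) auto
  also have "\<dots> = ((t - s) * D)\<^sup>2"
    by (simp add: power2_eq_square algebra_simps)
  finally show "dist p q \<le> (t - s) * dist x y"
    using assms by (auto intro: power2_le_imp_le[of "dist p q"] simp: D_def dist_commute)
  have "D \<le> dist x p + dist p q + dist y q"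
    unfolding D_def by metric
  also have "\<dots> \<le> s * D + dist p q + (1 - t) * D"
    using dist_start_comparison_point_le[OF p] dist_end_comparison_point_le[OF q] assms
    by (intro add_mono) (auto simp: D_def)
  finally show "(t - s) * dist x y \<le> dist p q"
    by (simp add: D_def algebra_simps)
qed

lemma dist_comparison_points:
  assumes p: "comparison_point x y s p" and q: "comparison_point x y t q"
    and "s \<in> {0..1}" "t \<in> {0..1}"
  shows "dist p q = \<bar>t - s\<bar> * dist x y"
proof (cases "s \<le> t")
  case True
  then show ?thesis using dist_comparison_points_ordered[OF p q] assms by simp
next
  case False
  then show ?thesis using dist_comparison_points_ordered[OF q p] assms by (simp add: dist_commute)
qed

lemma ex_comparison_point_midpoint:
  fixes x y :: "'a::hadamard_space"
  assumes p: "comparison_point x y s p" and q: "comparison_point x y t q"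
    and "s \<in> {0..1}" "t \<in> {0..1}"
  shows "\<exists>m. comparison_point x y ((s + t) / 2) m"
proof -
  obtain m where m: "\<And>z. (dist z m)\<^sup>2 \<le> 1/2 * (dist z p)\<^sup>2 + 1/2 * (dist z q)\<^sup>2 - 1/4 * (dist p q)\<^sup>2"
    using ex_CN_midpoint by blast
  have pq: "(dist p q)\<^sup>2 = (t - s)\<^sup>2 * (dist x y)\<^sup>2"
    using dist_comparison_points[OF assms] by (simp add: power_mult_distrib)
  have "comparison_point x y ((s + t) / 2) m"
    unfolding comparison_point_def
  proof
    fix z
    define A B D where "A = (dist z x)\<^sup>2" and "B = (dist z y)\<^sup>2" and "D = (dist x y)\<^sup>2"
    have "(dist z m)\<^sup>2 \<le> 1/2 * ((1 - s) * A + s * B - s * (1 - s) * D)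
        + 1/2 * ((1 - t) * A + t * B - t * (1 - t) * D) - 1/4 * ((t - s)\<^sup>2 * D)"
      unfolding A_def B_def D_def
      by (intro order_trans[OF m[of z, unfolded pq]] diff_right_mono add_mono mult_left_mono
          comparison_pointD[OF p] comparison_pointD[OF q]) auto
    also have "\<dots> = (1 - (s + t) / 2) * A + (s + t) / 2 * B
        - (s + t) / 2 * (1 - (s + t) / 2) * D"
      by (simp add: power2_eq_square field_simps)
    finally show "(dist z m)\<^sup>2 \<le> (1 - (s + t) / 2) * (dist z x)\<^sup>2 + (s + t) / 2 * (dist z y)\<^sup>2
        - (s + t) / 2 * (1 - (s + t) / 2) * (dist x y)\<^sup>2"
      unfolding A_def B_def D_def .
  qed
  then show ?thesis ..
qed

text \<open>
  By \<open>dist_comparison_points\<close>, comparison points for converging times form a Cauchy sequence,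
  so completeness supplies the limit point.
\<close>

lemma closed_comparison_times:
  fixes x y :: "'a::hadamard_space"
  shows "closed {t \<in> {0..1}. \<exists>p. comparison_point x y t p}"
  unfolding closed_sequential_limits
proof (intro allI impI, elim conjE)
  fix \<tau> :: "nat \<Rightarrow> real" and t
  assume \<tau>: "\<forall>n. \<tau> n \<in> {t \<in> {0..1}. \<exists>p. comparison_point x y t p}" and lim: "\<tau> \<longlonglongrightarrow> t"
  from \<tau> have t01: "\<And>n. \<tau> n \<in> {0..1}" by blast
  from \<tau> obtain p where p: "\<And>n. comparison_point x y (\<tau> n) (p n)" by (simp, metis)
  have "Cauchy p"
    unfolding Cauchy_def
  proof (intro allI impI)
    fix e :: real assume "0 < e"
    define \<delta> where "\<delta> = e / (dist x y + 1)"
    have D: "0 < dist x y + 1" by (simp add: add_nonneg_pos)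
    then have "0 < \<delta>" using \<open>0 < e\<close> by (simp add: \<delta>_def)
    then obtain N where N: "\<And>m n. m \<ge> N \<Longrightarrow> n \<ge> N \<Longrightarrow> dist (\<tau> m) (\<tau> n) < \<delta>"
      using LIMSEQ_imp_Cauchy[OF lim] unfolding Cauchy_def by metis
    have "dist (p m) (p n) < e" if "m \<ge> N" "n \<ge> N" for m n
    proof -
      have "dist (p m) (p n) = \<bar>\<tau> n - \<tau> m\<bar> * dist x y"
        by (rule dist_comparison_points[OF p p t01 t01])
      also have "\<dots> \<le> \<bar>\<tau> n - \<tau> m\<bar> * (dist x y + 1)"
        by (intro mult_left_mono) auto
      also have "\<dots> < \<delta> * (dist x y + 1)"
        using N[OF that] D by (intro mult_strict_right_mono) (auto simp: dist_real_def)
      also have "\<dots> = e" using D by (simp add: \<delta>_def)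
      finally show ?thesis .
    qed
    then show "\<exists>N. \<forall>m\<ge>N. \<forall>n\<ge>N. dist (p m) (p n) < e" by blast
  qed
  then obtain q where q: "p \<longlonglongrightarrow> q" using Cauchy_convergent convergent_def by blast
  have "comparison_point x y t q"
    unfolding comparison_point_def
  proof
    fix z
    show "(dist z q)\<^sup>2 \<le> (1 - t) * (dist z x)\<^sup>2 + t * (dist z y)\<^sup>2 - t * (1 - t) * (dist x y)\<^sup>2"
    proof (rule LIMSEQ_le)
      show "(\<lambda>n. (dist z (p n))\<^sup>2) \<longlonglongrightarrow> (dist z q)\<^sup>2"
        by (intro tendsto_intros q)
      show "(\<lambda>n. (1 - \<tau> n) * (dist z x)\<^sup>2 + \<tau> n * (dist z y)\<^sup>2
              - \<tau> n * (1 - \<tau> n) * (dist x y)\<^sup>2)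
            \<longlonglongrightarrow> (1 - t) * (dist z x)\<^sup>2 + t * (dist z y)\<^sup>2 - t * (1 - t) * (dist x y)\<^sup>2"
        by (intro tendsto_intros lim)
    qed (use comparison_pointD[OF p] in blast)
  qed
  moreover have "t \<in> {0..1}"
    using closed_sequentially[OF closed_atLeastAtMost] t01 lim by metis
  ultimately show "t \<in> {t \<in> {0..1}. \<exists>p. comparison_point x y t p}" by blast
qed

text \<open>
  A time without comparison point would lie in a gap of the closed set of times that have one, and
  the midpoint of the two ends of the gap contradicts the midpoint axiom. This takes the place of
  an extension from dyadic times.
\<close>

lemma ex_comparison_point:
  fixes x y :: "'a::hadamard_space"
  assumes "t \<in> {0..1}"
  shows "\<exists>p. comparison_point x y t p"
proof (rule ccontr)
  assume no: "\<not> ?thesis"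
  define T where "T = {t \<in> {0..1}. \<exists>p. comparison_point x y t p}"
  have closed: "closed T" unfolding T_def by (rule closed_comparison_times)
  have "0 \<in> T" "1 \<in> T"
    using comparison_point_start[of x y] comparison_point_end[of x y] by (auto simp: T_def)
  define a b where "a = Sup (T \<inter> {0..t})" and "b = Inf (T \<inter> {t..1})"
  have a: "a \<in> T \<inter> {0..t}" unfolding a_def
    using \<open>0 \<in> T\<close> assms closed by (intro closed_contains_Sup) auto
  have b: "b \<in> T \<inter> {t..1}" unfolding b_def
    using \<open>1 \<in> T\<close> assms closed by (intro closed_contains_Inf) auto
  have "t \<notin> T" using no by (simp add: T_def)
  then have "a < t" "t < b" using a b by (auto simp: less_le)
  have m: "(a + b) / 2 \<in> T"
    using a b ex_comparison_point_midpoint[of x y a _ b] by (auto simp: T_def)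
  show False
  proof (cases "(a + b) / 2 \<le> t")
    case True
    then have "(a + b) / 2 \<le> a"
      using m a b by (subst (2) a_def) (intro cSup_upper, auto simp: T_def)
    then show False using \<open>a < t\<close> \<open>t < b\<close> by simp
  next
    case False
    then have "b \<le> (a + b) / 2"
      using m a b by (subst (1) b_def) (intro cInf_lower, auto simp: T_def)
    then show False using \<open>a < t\<close> \<open>t < b\<close> by simp
  qed
qed

text \<open>
  Comparison points form a minimal geodesic, and a point of any other minimal geodesic has the same
  distances to the endpoints; the comparison inequality then forces it to coincide.
\<close>

lemma comparison_point_geodesic_point:
  fixes x y :: "'a::hadamard_space"
  assumes t: "t \<in> {0..1}"
  shows "comparison_point x y t (geodesic_point x t y)"
proof -
  have "\<forall>t\<in>{0..1}. \<exists>p. comparison_point x y t p" using ex_comparison_point by blast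
  then obtain \<gamma> where \<gamma>: "\<And>t. t \<in> {0..1} \<Longrightarrow> comparison_point x y t (\<gamma> t)"
    unfolding bchoice_iff by blast
  have ends: "\<gamma> 0 = x" "\<gamma> 1 = y"
    using dist_comparison_points[OF \<gamma> comparison_point_start, of 0]
      dist_comparison_points[OF \<gamma> comparison_point_end, of 1] by simp_all
  have geo: "minimal_geodesic x y \<gamma>"
    unfolding minimal_geodesic_def using ends dist_comparison_points[OF \<gamma> \<gamma>] by blast
  have "geodesic_point x t y = \<gamma> t"
    unfolding geodesic_point_def
  proof (rule the_equality)
    show "\<exists>\<gamma>'. minimal_geodesic x y \<gamma>' \<and> \<gamma>' t = \<gamma> t" using geo by blast
  next
    fix p assume "\<exists>\<gamma>'. minimal_geodesic x y \<gamma>' \<and> \<gamma>' t = p"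
    then obtain \<gamma>' where \<gamma>': "minimal_geodesic x y \<gamma>'" and p: "\<gamma>' t = p" by blast
    define D where "D = dist x y"
    have ends': "\<gamma>' 0 = x" "\<gamma>' 1 = y"
      and speed: "\<And>s. s \<in> {0..1} \<Longrightarrow> dist (\<gamma>' t) (\<gamma>' s) = \<bar>s - t\<bar> * D"
      using \<gamma>' t unfolding minimal_geodesic_def D_def by blast+
    have "dist p x = t * D" "dist p y = (1 - t) * D"
      using speed[of 0] speed[of 1] t unfolding ends' p by simp_all
    with comparison_pointD[OF \<gamma>[OF t], of p]
    have "(dist p (\<gamma> t))\<^sup>2 \<le> (1 - t) * (t * D)\<^sup>2 + t * ((1 - t) * D)\<^sup>2 - t * (1 - t) * D\<^sup>2"
      by (simp add: D_def)
    also have "\<dots> = 0" by (simp add: power2_eq_square algebra_simps)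
    finally show "p = \<gamma> t" by simp
  qed
  then show ?thesis using \<gamma>[OF t] by simp
qed

section \<open>Comparison inequalities for quadrilaterals\<close>

text \<open>
  Apply the comparison inequality on the diagonal \<open>x\<^sub>1 x\<^sub>3\<close> to \<open>x\<^sub>2\<close> and \<open>x\<^sub>4\<close> and bound the other
  diagonal by the detour through the point \<open>p\<close> at time \<open>t\<close>. This yields the claim with
  \<open>(1 - t) / t * d\<^sub>1\<^sub>2\<^sup>2 + t / (1 - t) * d\<^sub>3\<^sub>4\<^sup>2\<close> in place of \<open>2 d\<^sub>1\<^sub>2 d\<^sub>3\<^sub>4\<close>, and \<open>t\<close> is chosen to minimise it.
\<close>

lemma quadrilateral_inequality:
  fixes x1 x2 x3 x4 :: "'a::hadamard_space"
  shows "(dist x1 x3)\<^sup>2 + (dist x2 x4)\<^sup>2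
           \<le> (dist x2 x3)\<^sup>2 + (dist x4 x1)\<^sup>2 + 2 * dist x1 x2 * dist x3 x4"
proof (cases "x1 = x2 \<or> x3 = x4")
  case True
  then show ?thesis by (auto simp: dist_commute)
next
  case False
  define a c where "a = dist x1 x2" and "c = dist x3 x4"
  have pos: "a > 0" "c > 0" using False by (simp_all add: a_def c_def)
  define t where "t = a / (a + c)"
  have t: "0 < t" "t < 1" using pos by (simp_all add: t_def)
  have ratios: "(1 - t) / t * a\<^sup>2 + t / (1 - t) * c\<^sup>2 = 2 * a * c"
  proof -
    have "1 - t = c / (a + c)" using pos by (simp add: t_def field_simps)
    then have "(1 - t) / t = c / a" "t / (1 - t) = a / c"
      using pos by (simp_all add: t_def)
    then show ?thesis using pos by (simp add: power2_eq_square)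
  qed
  obtain p where p: "comparison_point x1 x3 t p"
    using ex_comparison_point[of t x1 x3] t by auto
  define u v where "u = dist x2 p" and "v = dist x4 p"
  define D where "D = (dist x1 x3)\<^sup>2"
  define b d where "b = (dist x2 x3)\<^sup>2" and "d = (dist x4 x1)\<^sup>2"
  have u: "u\<^sup>2 \<le> (1 - t) * a\<^sup>2 + t * b - t * (1 - t) * D"
    using comparison_pointD[OF p, of x2] by (simp add: u_def a_def b_def D_def dist_commute)
  have v: "v\<^sup>2 \<le> (1 - t) * d + t * c\<^sup>2 - t * (1 - t) * D"
    using comparison_pointD[OF p, of x4] by (simp add: v_def c_def d_def D_def dist_commute)
  have "(dist x2 x4)\<^sup>2 \<le> (u + v)\<^sup>2"
    unfolding u_def v_def by (intro power_mono) metric+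
  also have "(u + v)\<^sup>2 \<le> u\<^sup>2 / t + v\<^sup>2 / (1 - t)"
  proof -
    have "u\<^sup>2 / t + v\<^sup>2 / (1 - t) - (u + v)\<^sup>2 = ((1 - t) * u - t * v)\<^sup>2 / (t * (1 - t))"
      using t by (simp add: divide_simps) (simp add: power2_eq_square algebra_simps)
    also have "\<dots> \<ge> 0" using t by simp
    finally show ?thesis by simp
  qed
  also have "\<dots> \<le> ((1 - t) * a\<^sup>2 + t * b - t * (1 - t) * D) / t
      + ((1 - t) * d + t * c\<^sup>2 - t * (1 - t) * D) / (1 - t)"
    using t u v by (intro add_mono divide_right_mono) auto
  also have "\<dots> = b + d - D + ((1 - t) / t * a\<^sup>2 + t / (1 - t) * c\<^sup>2)"
    using t by (simp add: divide_simps) (simp add: algebra_simps)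
  finally show ?thesis
    unfolding ratios by (simp add: D_def b_def d_def a_def c_def)
qed

lemma dist_geodesic_point_common_start:
  fixes x y y' :: "'a::hadamard_space"
  assumes t: "t \<in> {0..1}"
  shows "dist (geodesic_point x t y) (geodesic_point x t y') \<le> t * dist y y'"
proof (rule power2_le_imp_le)
  define p q where "p = geodesic_point x t y" and "q = geodesic_point x t y'"
  define A B where "A = (dist x y)\<^sup>2" and "B = (dist x y')\<^sup>2"
  have p: "comparison_point x y t p" and q: "comparison_point x y' t q"
    using comparison_point_geodesic_point[OF t] by (simp_all add: p_def q_def)
  have "dist q x \<le> t * dist x y'"
    using dist_start_comparison_point_le[OF q] t by (simp add: dist_commute)
  then have "(dist q x)\<^sup>2 \<le> t\<^sup>2 * B"
    unfolding B_def power_mult_distrib[symmetric] by (intro power_mono) auto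
  moreover have "(dist q y)\<^sup>2 \<le> (1 - t) * A + t * (dist y y')\<^sup>2 - t * (1 - t) * B"
    using comparison_pointD[OF q, of y] by (simp add: A_def B_def dist_commute)
  ultimately have "(1 - t) * (dist q x)\<^sup>2 + t * (dist q y)\<^sup>2
      \<le> (1 - t) * (t\<^sup>2 * B) + t * ((1 - t) * A + t * (dist y y')\<^sup>2 - t * (1 - t) * B)"
    using t by (intro add_mono mult_left_mono) auto
  moreover have "(dist q p)\<^sup>2 \<le> (1 - t) * (dist q x)\<^sup>2 + t * (dist q y)\<^sup>2 - t * (1 - t) * A"
    unfolding A_def by (rule comparison_pointD[OF p])
  ultimately have "(dist q p)\<^sup>2
      \<le> (1 - t) * (t\<^sup>2 * B) + t * ((1 - t) * A + t * (dist y y')\<^sup>2 - t * (1 - t) * B)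
        - t * (1 - t) * A"
    by linarith
  also have "\<dots> = (t * dist y y')\<^sup>2"
    by (simp add: power2_eq_square algebra_simps)
  finally show "(dist (geodesic_point x t y) (geodesic_point x t y'))\<^sup>2 \<le> (t * dist y y')\<^sup>2"
    by (simp add: p_def q_def dist_commute)
qed (use t in simp)

lemma geodesic_point_reverse:
  fixes x y :: "'a::hadamard_space"
  assumes t: "t \<in> {0..1}"
  shows "geodesic_point x t y = geodesic_point y (1 - t) x"
proof -
  have "comparison_point y x (1 - t) (geodesic_point x t y)"
    by (rule comparison_point_reverse[OF comparison_point_geodesic_point[OF t]])
  from dist_comparison_points[OF this comparison_point_geodesic_point, of "1 - t"]
  show ?thesis using t by simp
qed

text \<open>Cut the quadrilateral along the diagonal from \<open>x\<close> to \<open>y'\<close>.\<close>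

lemma dist_geodesic_point_le:
  fixes x x' y y' :: "'a::hadamard_space"
  assumes t: "t \<in> {0..1}"
  shows "dist (geodesic_point x t y) (geodesic_point x' t y') \<le> (1 - t) * dist x x' + t * dist y y'"
proof -
  have "dist (geodesic_point x t y') (geodesic_point x' t y') \<le> (1 - t) * dist x x'"
    using dist_geodesic_point_common_start[of "1 - t" y' x x'] t
    by (simp add: geodesic_point_reverse[OF t, of _ y'])
  then show ?thesis
    using dist_geodesic_point_common_start[OF t, of x y y']
      dist_triangle[of "geodesic_point x t y" "geodesic_point x' t y'" "geodesic_point x t y'"]
    by linarith
qed

section \<open>Nonexpansiveness of the two means\<close>

lemma dist_inductive_mean_le:
  fixes x y :: "nat \<Rightarrow> 'a::hadamard_space"
  assumes "1 \<le> n"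
  shows "dist (inductive_mean x n) (inductive_mean y n) \<le> 1 / real n * (\<Sum>k=1..n. dist (x k) (y k))"
  using assms
proof (induction n rule: dec_induct)
  case base
  then show ?case by simp
next
  case (step n)
  define t where "t = 1 / real (Suc n)"
  obtain m where n: "n = Suc m" using step.hyps by (cases n) auto
  have t: "t \<in> {0..1}" by (simp add: t_def)
  have weight: "(1 - t) * (1 / real n) = t" using n by (simp add: t_def field_simps)
  have "dist (inductive_mean x (Suc n)) (inductive_mean y (Suc n))
      \<le> (1 - t) * dist (inductive_mean x n) (inductive_mean y n) + t * dist (x (Suc n)) (y (Suc n))"
    unfolding n inductive_mean.simps t_def[unfolded n, symmetric]
    by (rule dist_geodesic_point_le[OF t])
  also have "\<dots> \<le> (1 - t) * (1 / real n * (\<Sum>k=1..n. dist (x k) (y k))) + t * dist (x (Suc n)) (y (Suc n))"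
    using step.IH t by (intro add_mono mult_left_mono) auto
  also have "\<dots> = t * (\<Sum>k=1..Suc n. dist (x k) (y k))"
    unfolding mult.assoc[symmetric] weight by (simp add: algebra_simps)
  finally show ?case unfolding t_def .
qed

definition mean_sq_dist :: "(nat \<Rightarrow> 'a::metric_space) \<Rightarrow> nat \<Rightarrow> 'a \<Rightarrow> real" where
  "mean_sq_dist x n z = 1 / real n * (\<Sum>k=1..n. (dist (x k) z)\<^sup>2)"

lemma mean_sq_dist_comparison_point:
  assumes "comparison_point a b t p" "1 \<le> n"
  shows "mean_sq_dist x n p
           \<le> (1 - t) * mean_sq_dist x n a + t * mean_sq_dist x n b - t * (1 - t) * (dist a b)\<^sup>2"
proof -
  have "(\<Sum>k=1..n. (dist (x k) p)\<^sup>2) \<le> (\<Sum>k=1..n. (1 - t) * (dist (x k) a)\<^sup>2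
      + t * (dist (x k) b)\<^sup>2 - t * (1 - t) * (dist a b)\<^sup>2)"
    by (intro sum_mono comparison_pointD[OF assms(1)])
  also have "\<dots> = (1 - t) * (\<Sum>k=1..n. (dist (x k) a)\<^sup>2) + t * (\<Sum>k=1..n. (dist (x k) b)\<^sup>2)
      - real n * (t * (1 - t) * (dist a b)\<^sup>2)"
    by (simp add: sum.distrib sum_subtractf sum_distrib_left)
  finally show ?thesis
    using assms(2) by (simp add: mean_sq_dist_def field_simps)
qed

text \<open>
  By strong convexity, near-minimisers are close to each other. So a minimising sequence is Cauchy,
  and its limit is the only minimiser.
\<close>

lemma ex1_minimiser_mean_sq_dist:
  fixes x :: "nat \<Rightarrow> 'a::hadamard_space"
  assumes n: "1 \<le> n"
  shows "\<exists>!b. \<forall>z. mean_sq_dist x n b \<le> mean_sq_dist x n z"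
proof -
  define f where "f = mean_sq_dist x n"
  define I where "I = (INF z. f z)"
  have bdd: "bdd_below (range f)"
    by (rule bdd_belowI[of _ 0]) (auto simp: f_def mean_sq_dist_def sum_nonneg)
  have I: "I \<le> f z" for z unfolding I_def by (rule cINF_lower[OF bdd]) simp
  have near: "(dist a b)\<^sup>2 \<le> 2 * (f a - I) + 2 * (f b - I)" for a b
  proof -
    obtain m where "comparison_point a b (1/2) m" using ex_comparison_point[of "1/2" a b] by auto
    from mean_sq_dist_comparison_point[OF this n, of x] I[of m] show ?thesis
      by (simp add: f_def)
  qed
  have "\<exists>z. f z < I + 1 / real (Suc i)" for i
    using cInf_lessD[of "range f" "I + 1 / real (Suc i)"] by (auto simp: I_def)
  then obtain s where s: "\<And>i. f (s i) < I + 1 / real (Suc i)" by metis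
  have "Cauchy s"
    unfolding Cauchy_def
  proof (intro allI impI)
    fix e :: real assume "0 < e"
    then obtain N where N: "inverse (real (Suc N)) < e\<^sup>2 / 4"
      using reals_Archimedean[of "e\<^sup>2 / 4"] by auto
    have "dist (s i) (s j) < e" if "i \<ge> N" "j \<ge> N" for i j
    proof -
      have "1 / real (Suc i) \<le> 1 / real (Suc N)" "1 / real (Suc j) \<le> 1 / real (Suc N)"
        using that by (auto intro!: divide_left_mono)
      then have "(dist (s i) (s j))\<^sup>2 < e\<^sup>2"
        using near[of "s i" "s j"] s[of i] s[of j] N by (simp add: inverse_eq_divide)
      then show ?thesis using \<open>0 < e\<close> by (rule power2_less_imp_less[OF _ less_imp_le])
    qed
    then show "\<exists>N. \<forall>m\<ge>N. \<forall>n\<ge>N. dist (s m) (s n) < e" by blast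
  qed
  then obtain b where b: "s \<longlonglongrightarrow> b" using Cauchy_convergent convergent_def by blast
  have "f b \<le> I"
  proof (rule LIMSEQ_le)
    show "(\<lambda>i. f (s i)) \<longlonglongrightarrow> f b"
      unfolding f_def mean_sq_dist_def by (intro tendsto_intros b)
    show "(\<lambda>i. I + 1 / real (Suc i)) \<longlonglongrightarrow> I"
      using LIMSEQ_inverse_real_of_nat_add[of I] by (simp add: inverse_eq_divide)
  qed (use s in \<open>auto intro: less_imp_le\<close>)
  have "\<exists>!b. \<forall>z. f b \<le> f z"
  proof (rule ex1I[of _ b])
    show "\<forall>z. f b \<le> f z" using \<open>f b \<le> I\<close> I order_trans by blast
    fix c assume "\<forall>z. f c \<le> f z"
    then have "f c \<le> f b" by blast
    then have "2 * (f c - I) + 2 * (f b - I) \<le> 0" using \<open>f b \<le> I\<close> by simp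
    with near[of c b] have "(dist c b)\<^sup>2 \<le> 0" by (rule order_trans)
    then show "c = b" by simp
  qed
  then show ?thesis unfolding f_def .
qed

lemma frechet_mean_minimises:
  fixes x :: "nat \<Rightarrow> 'a::hadamard_space"
  assumes "1 \<le> n"
  shows "mean_sq_dist x n (frechet_mean x n) \<le> mean_sq_dist x n z"
proof -
  have "frechet_mean x n = (THE b. \<forall>z. mean_sq_dist x n b \<le> mean_sq_dist x n z)"
    unfolding frechet_mean_def is_arg_min_def mean_sq_dist_def by (simp add: not_less)
  then show ?thesis using theI'[OF ex1_minimiser_mean_sq_dist[OF assms, of x]] by simp
qed

text \<open>
  Compare the mean \<open>b\<close> with the point at time \<open>t\<close> on the geodesic to \<open>z\<close> and let \<open>t\<close> tend to \<open>0\<close>.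
\<close>

lemma variance_inequality:
  fixes x :: "nat \<Rightarrow> 'a::hadamard_space"
  assumes n: "1 \<le> n"
  shows "(dist (frechet_mean x n) z)\<^sup>2 \<le> mean_sq_dist x n z - mean_sq_dist x n (frechet_mean x n)"
proof -
  define b where "b = frechet_mean x n"
  define c where "c = mean_sq_dist x n z - mean_sq_dist x n b"
  have bound: "(1 - t) * (dist b z)\<^sup>2 \<le> c" if t: "0 < t" "t < 1" for t
  proof -
    obtain p where p: "comparison_point b z t p"
      using ex_comparison_point[of t b z] t by auto
    have "mean_sq_dist x n b \<le> mean_sq_dist x n p"
      unfolding b_def by (rule frechet_mean_minimises[OF n])
    also note mean_sq_dist_comparison_point[OF p n, of x]
    finally have "t * ((1 - t) * (dist b z)\<^sup>2) \<le> t * c"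
      by (simp add: c_def algebra_simps)
    then show ?thesis using t by simp
  qed
  have "(dist b z)\<^sup>2 \<le> c"
  proof (rule LIMSEQ_le_const2)
    show "(\<lambda>i. (1 - inverse (real (Suc i))) * (dist b z)\<^sup>2) \<longlonglongrightarrow> (dist b z)\<^sup>2"
      by (rule tendsto_eq_intros LIMSEQ_inverse_real_of_nat refl | simp)+
    \<comment> \<open>The time for \<open>i = 0\<close> would be \<open>1\<close>, where the bound is not available.\<close>
    show "\<exists>N. \<forall>i\<ge>N. (1 - inverse (real (Suc i))) * (dist b z)\<^sup>2 \<le> c"
      by (intro exI[of _ 1] allI impI bound) (auto simp: field_simps)
  qed
  then show ?thesis by (simp add: b_def c_def)
qed

lemma dist_frechet_mean_le:
  fixes x y :: "nat \<Rightarrow> 'a::hadamard_space"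
  assumes n: "1 \<le> n"
  shows "dist (frechet_mean x n) (frechet_mean y n) \<le> 1 / real n * (\<Sum>k=1..n. dist (x k) (y k))"
proof -
  define b c where "b = frechet_mean x n" and "c = frechet_mean y n"
  define S where "S = 1 / real n * (\<Sum>k=1..n. dist (x k) (y k))"
  have "2 * (dist b c)\<^sup>2 \<le> (mean_sq_dist x n c - mean_sq_dist x n b)
      + (mean_sq_dist y n b - mean_sq_dist y n c)"
    using variance_inequality[OF n, of x c] variance_inequality[OF n, of y b]
    by (simp add: b_def c_def dist_commute)
  also have "\<dots> = 1 / real n * (\<Sum>k=1..n. (dist (x k) c)\<^sup>2 - (dist (x k) b)\<^sup>2
      + ((dist (y k) b)\<^sup>2 - (dist (y k) c)\<^sup>2))"
    by (simp add: mean_sq_dist_def sum.distrib sum_subtractf algebra_simps add_divide_distrib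
        diff_divide_distrib)
  also have "\<dots> \<le> 1 / real n * (\<Sum>k=1..n. 2 * dist b c * dist (x k) (y k))"
  proof (intro mult_left_mono sum_mono)
    fix k
    show "(dist (x k) c)\<^sup>2 - (dist (x k) b)\<^sup>2 + ((dist (y k) b)\<^sup>2 - (dist (y k) c)\<^sup>2)
        \<le> 2 * dist b c * dist (x k) (y k)"
      using quadrilateral_inequality[of "x k" c "y k" b] by (simp add: dist_commute mult_ac)
  qed simp
  also have "\<dots> = 2 * dist b c * S"
    by (simp add: S_def sum_distrib_left[symmetric])
  finally have "dist b c * dist b c \<le> dist b c * S" by (simp add: power2_eq_square)
  moreover have "0 \<le> S" by (simp add: S_def sum_nonneg)
  ultimately have "dist b c \<le> S" by (cases "dist b c = 0") auto
  then show ?thesis by (simp add: b_def c_def S_def)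
qed

section \<open>Upper expectations\<close>

lemma upper_expectation_le:
  assumes "g \<in> borel_measurable M" "\<And>\<omega>. \<omega> \<in> space M \<Longrightarrow> f \<omega> \<le> g \<omega>"
  shows "upper_expectation M f \<le> (\<integral>\<^sup>+\<omega>. g \<omega> \<partial>M)"
  unfolding upper_expectation_def using assms by (intro INF_lower) auto

text \<open>The pointwise infimum of a minimising sequence of majorants attains the infimum.\<close>

lemma upper_expectation_attained:
  obtains g where "g \<in> borel_measurable M" "\<And>\<omega>. \<omega> \<in> space M \<Longrightarrow> f \<omega> \<le> g \<omega>"
    "upper_expectation M f = (\<integral>\<^sup>+\<omega>. g \<omega> \<partial>M)"
proof -
  define G where "G = {g \<in> borel_measurable M. \<forall>\<omega>\<in>space M. f \<omega> \<le> g \<omega>}"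
  have "(\<lambda>_. top) \<in> G" by (simp add: G_def)
  then have "integral\<^sup>N M ` G \<noteq> {}" by blast
  from ennreal_Inf_countable_INF[OF this] obtain J :: "nat \<Rightarrow> ennreal" where J: "range J \<subseteq> integral\<^sup>N M ` G"
    and inf: "Inf (integral\<^sup>N M ` G) = (INF i. J i)"
    by blast
  then have "\<forall>i. \<exists>g. g \<in> G \<and> J i = integral\<^sup>N M g" by blast
  then obtain g where g: "\<And>i. g i \<in> G" and J_eq: "\<And>i. J i = integral\<^sup>N M (g i)" by metis
  define h where "h \<omega> = (INF i. g i \<omega>)" for \<omega>
  have meas: "h \<in> borel_measurable M"
    unfolding h_def using g by (intro borel_measurable_INF) (auto simp: G_def)
  have dom: "f \<omega> \<le> h \<omega>" if "\<omega> \<in> space M" for \<omega>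
    unfolding h_def using g that by (intro INF_greatest) (auto simp: G_def)
  have "integral\<^sup>N M h \<le> (INF i. J i)"
    unfolding J_eq h_def by (intro INF_greatest nn_integral_mono INF_lower) simp
  then have "integral\<^sup>N M h \<le> upper_expectation M f"
    unfolding inf[symmetric] upper_expectation_def G_def by simp
  with upper_expectation_le[OF meas dom] have "upper_expectation M f = integral\<^sup>N M h"
    by (intro antisym) auto
  with meas dom that show thesis by blast
qed

lemma upper_expectation_mono:
  assumes "\<And>\<omega>. \<omega> \<in> space M \<Longrightarrow> f \<omega> \<le> g \<omega>"
  shows "upper_expectation M f \<le> upper_expectation M g"
proof -
  obtain h where h: "h \<in> borel_measurable M" "\<And>\<omega>. \<omega> \<in> space M \<Longrightarrow> g \<omega> \<le> h \<omega>"
    "upper_expectation M g = (\<integral>\<^sup>+\<omega>. h \<omega> \<partial>M)"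
    by (rule upper_expectation_attained[of M g]) blast
  show ?thesis
    unfolding h(3) by (rule upper_expectation_le[OF h(1) order_trans[OF assms h(2)]])
qed

lemma upper_expectation_add:
  "upper_expectation M (\<lambda>\<omega>. f \<omega> + g \<omega>) \<le> upper_expectation M f + upper_expectation M g"
proof -
  obtain u where u: "u \<in> borel_measurable M" "\<And>\<omega>. \<omega> \<in> space M \<Longrightarrow> f \<omega> \<le> u \<omega>"
    "upper_expectation M f = (\<integral>\<^sup>+\<omega>. u \<omega> \<partial>M)"
    by (rule upper_expectation_attained[of M f]) blast
  obtain v where v: "v \<in> borel_measurable M" "\<And>\<omega>. \<omega> \<in> space M \<Longrightarrow> g \<omega> \<le> v \<omega>"
    "upper_expectation M g = (\<integral>\<^sup>+\<omega>. v \<omega> \<partial>M)"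
    by (rule upper_expectation_attained[of M g]) blast
  have "upper_expectation M (\<lambda>\<omega>. f \<omega> + g \<omega>) \<le> (\<integral>\<^sup>+\<omega>. u \<omega> + v \<omega> \<partial>M)"
    using u v by (intro upper_expectation_le add_mono) auto
  also have "\<dots> = upper_expectation M f + upper_expectation M g"
    using u v by (simp add: nn_integral_add)
  finally show ?thesis .
qed

lemma upper_expectation_cmult:
  "upper_expectation M (\<lambda>\<omega>. c * f \<omega>) \<le> c * upper_expectation M f"
proof -
  obtain u where u: "u \<in> borel_measurable M" "\<And>\<omega>. \<omega> \<in> space M \<Longrightarrow> f \<omega> \<le> u \<omega>"
    "upper_expectation M f = (\<integral>\<^sup>+\<omega>. u \<omega> \<partial>M)"
    by (rule upper_expectation_attained[of M f]) blast
  have "upper_expectation M (\<lambda>\<omega>. c * f \<omega>) \<le> (\<integral>\<^sup>+\<omega>. c * u \<omega> \<partial>M)"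
    using u by (intro upper_expectation_le mult_left_mono) auto
  also have "\<dots> = c * upper_expectation M f"
    using u by (simp add: nn_integral_cmult)
  finally show ?thesis .
qed

lemma upper_expectation_sum:
  assumes "finite I"
  shows "upper_expectation M (\<lambda>\<omega>. \<Sum>i\<in>I. f i \<omega>) \<le> (\<Sum>i\<in>I. upper_expectation M (f i))"
  using assms
proof (induction I rule: finite_induct)
  case empty
  then show ?case by (simp add: upper_expectation_eq_nn_integral)
next
  case (insert i I)
  have "upper_expectation M (\<lambda>\<omega>. f i \<omega> + (\<Sum>i\<in>I. f i \<omega>))
      \<le> upper_expectation M (f i) + (\<Sum>i\<in>I. upper_expectation M (f i))"
    by (rule order_trans[OF upper_expectation_add add_left_mono[OF insert.IH]])
  then show ?case using insert.hyps by simp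
qed

lemma dist_sq_le_twice_sum_sq:
  fixes x y z :: "'a::metric_space"
  shows "(dist x z)\<^sup>2 \<le> 2 * (dist x y)\<^sup>2 + 2 * (dist y z)\<^sup>2"
proof -
  have "(dist x z)\<^sup>2 \<le> (dist x y + dist y z)\<^sup>2"
    by (intro power_mono dist_triangle) simp
  also have "\<dots> \<le> 2 * (dist x y)\<^sup>2 + 2 * (dist y z)\<^sup>2"
    using sum_squares_bound[of "dist x y" "dist y z"] by (simp add: power2_sum)
  finally show ?thesis .
qed

section \<open>Transfer of mean-square convergence\<close>

text \<open>
  Nonexpansiveness and Jensen's inequality give \<open>d (T x, T y)\<^sup>2 \<le> 1/n \<Sum> d (x\<^sub>k, y\<^sub>k)\<^sup>2\<close>; the factor \<open>1/n\<close>
  is what the assumed averages can absorb.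
\<close>

lemma tendsto_L2_nonexpansive_mean:
  fixes X Y :: "nat \<Rightarrow> 'w \<Rightarrow> 'a::metric_space" and T :: "(nat \<Rightarrow> 'a) \<Rightarrow> nat \<Rightarrow> 'a"
  assumes nonexp: "\<And>x y n. 1 \<le> n \<Longrightarrow>
      dist (T x n) (T y n) \<le> 1 / real n * (\<Sum>k=1..n. dist (x k) (y k))"
    and small: "(\<lambda>n. (\<Sum>k=1..n. upper_expectation M (\<lambda>\<omega>. ennreal ((dist (X k \<omega>) (Y k \<omega>))\<^sup>2)))
                  / of_nat n) \<longlonglongrightarrow> 0"
    and conv: "tendsto_L2 M (\<lambda>n \<omega>. T (\<lambda>k. X k \<omega>) n) W"
  shows "tendsto_L2 M (\<lambda>n \<omega>. T (\<lambda>k. Y k \<omega>) n) W"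
proof -
  define E where "E k = upper_expectation M (\<lambda>\<omega>. ennreal ((dist (X k \<omega>) (Y k \<omega>))\<^sup>2))" for k
  define A where "A n = upper_expectation M (\<lambda>\<omega>. ennreal ((dist (T (\<lambda>k. X k \<omega>) n) (W \<omega>))\<^sup>2))" for n
  define B where "B n = upper_expectation M (\<lambda>\<omega>. ennreal ((dist (T (\<lambda>k. Y k \<omega>) n) (W \<omega>))\<^sup>2))" for n
  have bound: "B n \<le> 2 * A n + 2 * ((\<Sum>k=1..n. E k) / of_nat n)" if n: "1 \<le> n" for n
  proof -
    define c where "c = ennreal (2 / real n)"
    have pointwise: "ennreal ((dist (T (\<lambda>k. Y k \<omega>) n) (W \<omega>))\<^sup>2)
        \<le> 2 * ennreal ((dist (T (\<lambda>k. X k \<omega>) n) (W \<omega>))\<^sup>2)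
          + c * (\<Sum>k=1..n. ennreal ((dist (X k \<omega>) (Y k \<omega>))\<^sup>2))" for \<omega>
    proof -
      define x y where "x = (\<lambda>k. X k \<omega>)" and "y = (\<lambda>k. Y k \<omega>)"
      define S where "S = (\<Sum>k=1..n. (dist (x k) (y k))\<^sup>2)"
      have "(dist (T x n) (T y n))\<^sup>2 \<le> (1 / real n * (\<Sum>k=1..n. dist (x k) (y k)))\<^sup>2"
        by (intro power_mono nonexp n) simp
      also have "\<dots> \<le> (1 / real n)\<^sup>2 * (S * real n)"
        unfolding power_mult_distrib S_def
        using sum_squared_le_sum_of_squares[of "\<lambda>k. dist (x k) (y k)" "{1..n}"]
        by (intro mult_left_mono) auto
      also have "\<dots> = S / real n" using n by (simp add: power2_eq_square)
      finally have "(dist (T y n) (W \<omega>))\<^sup>2 \<le> 2 * (dist (T x n) (W \<omega>))\<^sup>2 + 2 / real n * S"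
        using dist_sq_le_twice_sum_sq[of "T y n" "W \<omega>" "T x n"] by (simp add: dist_commute)
      then have "ennreal ((dist (T y n) (W \<omega>))\<^sup>2)
          \<le> ennreal (2 * (dist (T x n) (W \<omega>))\<^sup>2 + 2 / real n * S)"
        by (rule ennreal_leI)
      also have "\<dots> = 2 * ennreal ((dist (T x n) (W \<omega>))\<^sup>2) + c * ennreal S"
        unfolding c_def S_def
        by (subst ennreal_plus) (auto simp: ennreal_mult' ennreal_mult'' sum_nonneg simp flip: ennreal_mult)
      finally show ?thesis by (simp add: x_def y_def S_def)
    qed
    have "B n \<le> upper_expectation M (\<lambda>\<omega>. 2 * ennreal ((dist (T (\<lambda>k. X k \<omega>) n) (W \<omega>))\<^sup>2)
          + c * (\<Sum>k=1..n. ennreal ((dist (X k \<omega>) (Y k \<omega>))\<^sup>2)))"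
      unfolding B_def by (rule upper_expectation_mono) (rule pointwise)
    also have "\<dots> \<le> 2 * A n + c * upper_expectation M
        (\<lambda>\<omega>. \<Sum>k=1..n. ennreal ((dist (X k \<omega>) (Y k \<omega>))\<^sup>2))"
      unfolding A_def
      by (intro order_trans[OF upper_expectation_add] add_mono upper_expectation_cmult)
    also have "\<dots> \<le> 2 * A n + c * (\<Sum>k=1..n. E k)"
      unfolding E_def by (intro add_mono mult_left_mono upper_expectation_sum) auto
    also have "c * (\<Sum>k=1..n. E k) = 2 * ((\<Sum>k=1..n. E k) / of_nat n)"
    proof -
      have "c = 2 / of_nat n"
        using n divide_ennreal[of 2 "real n"] by (simp add: c_def ennreal_of_nat_eq_real_of_nat)
      then show ?thesis by (simp add: ennreal_times_divide ennreal_divide_times)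
    qed
    finally show ?thesis .
  qed
  have "(\<lambda>n. 2 * A n + 2 * ((\<Sum>k=1..n. E k) / of_nat n)) \<longlonglongrightarrow> 2 * 0 + 2 * 0"
    using conv small unfolding tendsto_L2_def A_def E_def
    by (intro tendsto_add ennreal_tendsto_cmult) auto
  then have lim: "(\<lambda>n. 2 * A n + 2 * ((\<Sum>k=1..n. E k) / of_nat n)) \<longlonglongrightarrow> 0" by simp
  have "B \<longlonglongrightarrow> 0"
    by (rule tendsto_sandwich[OF _ _ tendsto_const lim])
      (use bound in \<open>auto simp: eventually_sequentially\<close>)
  then show ?thesis by (simp add: tendsto_L2_def B_def[abs_def])
qed

lemma max_sq_dist_small_change_point:
  fixes X :: "nat \<Rightarrow> 'w \<Rightarrow> 'a::metric_space"
  assumes "prob_space M" and small: "max_sq_dist_small M X a"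
  shows "max_sq_dist_small M X b"
proof -
  interpret prob_space M by fact
  define A where "A a n = upper_expectation M (\<lambda>\<omega>. ennreal (MAX k\<in>{1..n}. (dist (X k \<omega>) a)\<^sup>2))" for a n
  define r where "r = 2 * (dist a b)\<^sup>2"
  have bound: "A b n / of_nat n \<le> 2 * (A a n / of_nat n) + ennreal (r / real n)" if n: "1 \<le> n" for n
  proof -
    have pointwise: "ennreal (MAX k\<in>{1..n}. (dist (X k \<omega>) b)\<^sup>2)
        \<le> 2 * ennreal (MAX k\<in>{1..n}. (dist (X k \<omega>) a)\<^sup>2) + ennreal r" for \<omega>
    proof -
      define m where "m = (MAX k\<in>{1..n}. (dist (X k \<omega>) a)\<^sup>2)"
      have m: "(dist (X k \<omega>) a)\<^sup>2 \<le> m" if "k \<in> {1..n}" for k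
        unfolding m_def using that by (intro Max_ge) auto
      have "0 \<le> m" using m[of 1] n order_trans[OF zero_le_power2] by auto
      have "(MAX k\<in>{1..n}. (dist (X k \<omega>) b)\<^sup>2) \<le> 2 * m + r"
      proof (rule Max.boundedI)
        fix s assume "s \<in> (\<lambda>k. (dist (X k \<omega>) b)\<^sup>2) ` {1..n}"
        then obtain k where k: "k \<in> {1..n}" "s = (dist (X k \<omega>) b)\<^sup>2" by blast
        show "s \<le> 2 * m + r"
          using dist_sq_le_twice_sum_sq[of "X k \<omega>" b a] m[OF k(1)] k(2) by (simp add: r_def)
      qed (use n in auto)
      then have "ennreal (MAX k\<in>{1..n}. (dist (X k \<omega>) b)\<^sup>2) \<le> ennreal (2 * m + r)"
        by (rule ennreal_leI)
      also have "\<dots> = 2 * ennreal m + ennreal r"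
        using \<open>0 \<le> m\<close> by (subst ennreal_plus) (auto simp: r_def ennreal_mult' ennreal_mult'')
      finally show ?thesis unfolding m_def .
    qed
    have "A b n \<le> upper_expectation M
        (\<lambda>\<omega>. 2 * ennreal (MAX k\<in>{1..n}. (dist (X k \<omega>) a)\<^sup>2) + ennreal r)"
      unfolding A_def by (rule upper_expectation_mono) (rule pointwise)
    also have "\<dots> \<le> 2 * A a n + upper_expectation M (\<lambda>_. ennreal r)"
      unfolding A_def by (intro order_trans[OF upper_expectation_add] add_mono upper_expectation_cmult) simp
    also have "upper_expectation M (\<lambda>_. ennreal r) = ennreal r"
      by (simp add: upper_expectation_eq_nn_integral emeasure_space_1)
    finally have "A b n / of_nat n \<le> (2 * A a n + ennreal r) / of_nat n"
      by (rule divide_right_mono_ennreal)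
    also have "\<dots> = 2 * (A a n / of_nat n) + ennreal r / ennreal (real n)"
      by (simp add: add_divide_distrib_ennreal ennreal_times_divide ennreal_of_nat_eq_real_of_nat)
    also have "ennreal r / ennreal (real n) = ennreal (r / real n)"
      using n by (intro divide_ennreal) (auto simp: r_def)
    finally show ?thesis .
  qed
  have "(\<lambda>n. 2 * (A a n / of_nat n) + ennreal (r / real n)) \<longlonglongrightarrow> 2 * 0 + ennreal 0"
    using small lim_const_over_n[of r] unfolding max_sq_dist_small_def A_def
    by (intro tendsto_add ennreal_tendsto_cmult tendsto_ennrealI) auto
  then have lim: "(\<lambda>n. 2 * (A a n / of_nat n) + ennreal (r / real n)) \<longlonglongrightarrow> 0" by simp
  have "(\<lambda>n. A b n / of_nat n) \<longlonglongrightarrow> 0"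
    by (rule tendsto_sandwich[OF _ _ tendsto_const lim])
      (use bound in \<open>auto simp: eventually_sequentially\<close>)
  then show ?thesis by (simp add: max_sq_dist_small_def A_def)
qed

theorem proposition2:
  fixes M :: "'w measure"
    and X Y :: "nat \<Rightarrow> 'w \<Rightarrow> 'a::hadamard_space"
    and \<mu> :: 'a
  assumes "prob_space M"
    and "\<And>k. 1 \<le> k \<Longrightarrow> X k \<in> measurable M borel"
    and "\<And>k. 1 \<le> k \<Longrightarrow> Y k \<in> measurable M borel"
    and "(\<lambda>n. (\<Sum>k=1..n. upper_expectation M (\<lambda>\<omega>. ennreal ((dist (X k \<omega>) (Y k \<omega>))\<^sup>2))) / of_nat n)
           \<longlonglongrightarrow> 0"
  shows "(tendsto_L2 M (\<lambda>n \<omega>. inductive_mean (\<lambda>k. X k \<omega>) n) (\<lambda>_. \<mu>) \<longrightarrow>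
            tendsto_L2 M (\<lambda>n \<omega>. inductive_mean (\<lambda>k. Y k \<omega>) n) (\<lambda>_. \<mu>))
       \<and> ((\<exists>a. max_sq_dist_small M X a) \<longrightarrow> (\<forall>a. max_sq_dist_small M X a))
       \<and> ((\<exists>a. max_sq_dist_small M X a) \<and>
          tendsto_L2 M (\<lambda>n \<omega>. frechet_mean (\<lambda>k. X k \<omega>) n) (\<lambda>_. \<mu>) \<longrightarrow>
            tendsto_L2 M (\<lambda>n \<omega>. frechet_mean (\<lambda>k. Y k \<omega>) n) (\<lambda>_. \<mu>))"
  using tendsto_L2_nonexpansive_mean[of inductive_mean, OF dist_inductive_mean_le assms(4)]
    tendsto_L2_nonexpansive_mean[of frechet_mean, OF dist_frechet_mean_le assms(4)]
    max_sq_dist_small_change_point[OF assms(1)]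
  by blast

end
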